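(* Let $\alpha,\beta,\gamma>0$ be real numbers with $\alpha\beta\gamma=1$. Then the quadratic form on $\mathbb R^{3\times 3}$ $$Q(\xi)=(\xi_{11}^2+\xi_{22}^2+\xi_{33}^2-2\xi_{11}\xi_{22}-2\xi_{22}\xi_{33}-2\xi_{33}\xi_{11})+\alpha\xi_{12}^2+\beta\xi_{23}^2+\gamma\xi_{31}^2$$ is an extremal quasiconvex quadratic form, in the sense that it is quasiconvex and one cannot subtract from it a quasiconvex quadratic form, other than a multiple of $Q$ modulo null-Lagrangians, while preserving quasiconvexity.
   Context: For $x,y\in\mathbb R^3$, $x\otimes y$ denotes the matrix with entries $(x\otimes y)_{ij}=x_iy_j$. A quadratic form $f$ on $\mathbb R^{3\times3}$ is quasiconvex if and only if $f(x\otimes y)\ge 0$ for all $x,y\in\mathbb R^3$ (for quadratic forms this is equivalent to Morrey's quasiconvexity and to rank-one convexity). A null-Lagrangian quadratic form is a linear combination of the nine $2\times 2$ minors of $\xi$ (equivalently, a quadratic form vanishing on all matrices $x\otimes y$). The extremality condition for a quasiconvex quadratic form $f$ means: whenever $g$ and $f-g$ are both quasiconvex quadratic forms, there is $\lambda\in\mathbb R$ such that $g-\lambda f$ is a null-Lagrangian. *)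

theory Defs
  imports "HOL-Analysis.Analysis"
begin

definition tensor :: "real^3 \<Rightarrow> real^3 \<Rightarrow> real^3^3"  (infixl "\<otimes>\<^sub>t" 75)
  where "x \<otimes>\<^sub>t y = (\<chi> i j. x $ i * y $ j)"

definition quadratic_form :: "(real^3^3 \<Rightarrow> real) \<Rightarrow> bool"
  where "quadratic_form f \<longleftrightarrow> (\<exists>B. bilinear B \<and> (\<forall>\<xi>. f \<xi> = B \<xi> \<xi>))"

text \<open>Quasiconvexity of a quadratic form, where it coincides with rank-one convexity.\<close>

definition quasiconvex_form :: "(real^3^3 \<Rightarrow> real) \<Rightarrow> bool"
  where "quasiconvex_form f \<longleftrightarrow> quadratic_form f \<and> (\<forall>x y. f (x \<otimes>\<^sub>t y) \<ge> 0)"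

text \<open>Arithmetic in the index type 3 is modulo 3, so rows \<open>i + 1, i + 2\<close> and columns
  \<open>j + 1, j + 2\<close> are those that remain after deleting row \<open>i\<close> and column \<open>j\<close>. Taking them
  in cyclic order gives the minor up to sign.\<close>

definition minor :: "3 \<Rightarrow> 3 \<Rightarrow> real^3^3 \<Rightarrow> real"
  where "minor i j \<xi> = \<xi> $ (i + 1) $ (j + 1) * \<xi> $ (i + 2) $ (j + 2)
                      - \<xi> $ (i + 1) $ (j + 2) * \<xi> $ (i + 2) $ (j + 1)"

definition null_lagrangian :: "(real^3^3 \<Rightarrow> real) \<Rightarrow> bool"
  where "null_lagrangian f \<longleftrightarrow>
    (\<exists>c :: 3 \<Rightarrow> 3 \<Rightarrow> real. \<forall>\<xi>. f \<xi> = (\<Sum>i\<in>UNIV. \<Sum>j\<in>UNIV. c i j * minor i j \<xi>))"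

definition extremal_quasiconvex_form :: "(real^3^3 \<Rightarrow> real) \<Rightarrow> bool"
  where "extremal_quasiconvex_form f \<longleftrightarrow> quasiconvex_form f \<and>
    (\<forall>g. quasiconvex_form g \<and> quasiconvex_form (\<lambda>\<xi>. f \<xi> - g \<xi>) \<longrightarrow>
      (\<exists>t :: real. null_lagrangian (\<lambda>\<xi>. g \<xi> - t * f \<xi>)))"

end

theory Submission
  imports Defs
begin

text \<open>
  Conjugating by a diagonal matrix reduces to \<open>\<alpha> = \<beta> = \<gamma> = 1\<close>. Writing \<open>\<xi> = x \<otimes> y\<close>,
  \<open>a = x\<^sub>1y\<^sub>1\<close>, \<open>b = x\<^sub>2y\<^sub>2\<close>, \<open>c = x\<^sub>3y\<^sub>3\<close> and \<open>p = x\<^sub>1y\<^sub>2\<close>, \<open>q = x\<^sub>2y\<^sub>3\<close>, \<open>r = x\<^sub>3y\<^sub>1\<close>, we have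
  \<open>abc = pqr\<close>, so AM-GM bounds \<open>p\<^sup>2 + q\<^sup>2 + r\<^sup>2\<close> below by three times the cube root of \<open>(abc)\<^sup>2\<close>.
  If \<open>a, b, c\<close> have the same sign (otherwise the form is a sum of nonnegative terms), nonnegativity is Schur's inequality in the cube roots of \<open>a\<^sup>2, b\<^sup>2, c\<^sup>2\<close>.

  For extremality, let \<open>0 \<le> g \<le> Q\<close> on rank-one matrices. Every rank-one zero of \<open>Q\<close> is a zero,
  hence a critical point, of \<open>g\<close> there. The zeros are \<open>e\<^sub>1 \<otimes> e\<^sub>3\<close>, \<open>e\<^sub>2 \<otimes> e\<^sub>1\<close>, \<open>e\<^sub>3 \<otimes> e\<^sub>2\<close> and
  \<open>\<epsilon> \<otimes> \<epsilon>\<close> for the sign vectors \<open>\<epsilon>\<close>. Criticality there, together with the Hessian at the first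
  three zeros along the kernel of the Hessian of \<open>Q\<close>, is a linear system in the coefficients of
  the biquadratic form \<open>g (x \<otimes> y)\<close> whose solution space is spanned by that of \<open>Q\<close>. So some
  \<open>g - t Q\<close> vanishes on rank-one matrices, and is therefore a null-Lagrangian.
\<close>

section \<open>Rank-one matrices, coordinates and quadratic forms\<close>

definition unit_matrix :: "3 \<Rightarrow> 3 \<Rightarrow> real^3^3"
  where "unit_matrix i j = axis i 1 \<otimes>\<^sub>t axis j 1"

lemma tensor_nth [simp]: "(x \<otimes>\<^sub>t y) $ i $ j = x $ i * y $ j"
  by (simp add: tensor_def)

lemma tensor_add_left: "(x + x') \<otimes>\<^sub>t y = x \<otimes>\<^sub>t y + x' \<otimes>\<^sub>t y"
  and tensor_add_right: "x \<otimes>\<^sub>t (y + y') = x \<otimes>\<^sub>t y + x \<otimes>\<^sub>t y'"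
  and tensor_scale_left: "(c *\<^sub>R x) \<otimes>\<^sub>t y = c *\<^sub>R (x \<otimes>\<^sub>t y)"
  and tensor_scale_right: "x \<otimes>\<^sub>t (c *\<^sub>R y) = c *\<^sub>R (x \<otimes>\<^sub>t y)"
  by (simp_all add: vec_eq_iff algebra_simps)

lemma matrix_unit_expansion:
  "\<xi> = (\<Sum>i\<in>UNIV. \<Sum>j\<in>UNIV. \<xi> $ i $ j *\<^sub>R unit_matrix i j)"
  by (simp add: vec_eq_iff forall_3 sum_3 unit_matrix_def axis_def)

lemma bilinear_coords:
  assumes "bilinear B"
  shows "B \<xi> \<eta> = (\<Sum>i\<in>UNIV. \<Sum>j\<in>UNIV. \<Sum>k\<in>UNIV. \<Sum>l\<in>UNIV.
    \<xi> $ i $ j * \<eta> $ k $ l * (B (unit_matrix i j) (unit_matrix k l) :: real))"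
proof -
  have lin: "linear (\<lambda>\<xi>. B \<xi> \<eta>)" "linear (B \<xi>)" for \<xi> \<eta>
    using assms by (auto simp: bilinear_def)
  have "B \<xi> \<eta> = B (\<Sum>i\<in>UNIV. \<Sum>j\<in>UNIV. \<xi> $ i $ j *\<^sub>R unit_matrix i j)
    (\<Sum>i\<in>UNIV. \<Sum>j\<in>UNIV. \<eta> $ i $ j *\<^sub>R unit_matrix i j)"
    using matrix_unit_expansion by metis
  also have "\<dots> = (\<Sum>i\<in>UNIV. \<Sum>j\<in>UNIV. \<xi> $ i $ j *
    B (unit_matrix i j) (\<Sum>k\<in>UNIV. \<Sum>l\<in>UNIV. \<eta> $ k $ l *\<^sub>R unit_matrix k l))"
    by (simp add: linear_sum[OF lin(1)] linear_cmul[OF lin(1)])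
  also have "\<dots> = (\<Sum>i\<in>UNIV. \<Sum>j\<in>UNIV. \<Sum>k\<in>UNIV. \<Sum>l\<in>UNIV.
    \<xi> $ i $ j * \<eta> $ k $ l * B (unit_matrix i j) (unit_matrix k l))"
    by (simp add: linear_sum[OF lin(2)] linear_cmul[OF lin(2)] sum_distrib_left mult.assoc)
  finally show ?thesis .
qed

text \<open>Averaging a representing \<open>B\<close> with its transpose keeps the values on the
  diagonal; the polarization arguments rely on the symmetry gained.\<close>

lemma quadratic_form_symmetric:
  assumes "quadratic_form f"
  obtains B where "bilinear B" "\<And>\<xi> \<eta>. B \<xi> \<eta> = B \<eta> \<xi>" "\<And>\<xi>. f \<xi> = B \<xi> \<xi>"
proof -
  obtain B where B: "bilinear B" "\<And>\<xi>. f \<xi> = B \<xi> \<xi>"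
    using assms by (auto simp: quadratic_form_def)
  show thesis
  proof
    show "bilinear (\<lambda>\<xi> \<eta>. (B \<xi> \<eta> + B \<eta> \<xi>) / 2)"
      using B(1) unfolding bilinear_def
      by (auto intro!: linearI simp: linear_add linear_cmul add_divide_distrib
          linear_add[of "\<lambda>x. B x _"] linear_cmul[of "\<lambda>x. B x _"] distrib_left)
  qed (simp_all add: B(2))
qed

lemma quadratic_form_diff_scale:
  assumes "quadratic_form f" "quadratic_form g"
  shows "quadratic_form (\<lambda>\<xi>. f \<xi> - t * g \<xi>)"
proof -
  obtain B C where *: "bilinear B" "\<And>\<xi>. f \<xi> = B \<xi> \<xi>" "bilinear C" "\<And>\<xi>. g \<xi> = C \<xi> \<xi>"
    using assms by (auto simp: quadratic_form_def)
  have "bilinear (\<lambda>\<xi> \<eta>. B \<xi> \<eta> - t * C \<xi> \<eta>)"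
    using *(1,3) unfolding bilinear_def
    by (auto intro!: linearI simp: linear_add linear_cmul algebra_simps
        linear_add[of "\<lambda>x. B x _"] linear_cmul[of "\<lambda>x. B x _"]
        linear_add[of "\<lambda>x. C x _"] linear_cmul[of "\<lambda>x. C x _"])
  then show ?thesis
    using * by (auto simp: quadratic_form_def intro!: exI[of _ "\<lambda>\<xi> \<eta>. B \<xi> \<eta> - t * C \<xi> \<eta>"])
qed

lemma quadratic_form_linear_compose:
  assumes "quadratic_form f" "linear T"
  shows "quadratic_form (\<lambda>\<xi>. f (T \<xi>))"
proof -
  obtain B where B: "bilinear B" "\<And>\<xi>. f \<xi> = B \<xi> \<xi>"
    using assms(1) by (auto simp: quadratic_form_def)
  have "bilinear (\<lambda>\<xi> \<eta>. B (T \<xi>) (T \<eta>))"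
    using B(1) linear_compose[OF assms(2), of "B (T _)"]
      linear_compose[OF assms(2), of "\<lambda>\<xi>. B \<xi> (T _)"]
    by (simp add: bilinear_def o_def)
  then show ?thesis
    using B(2) by (auto simp: quadratic_form_def)
qed

text \<open>Polarizing in \<open>x\<close> and then in \<open>y\<close> makes the coefficients
  antisymmetric under exchange of the two column indices. Products of entries from a common row or
  column drop out, and the others pair up into minors.\<close>

lemma null_lagrangianI:
  assumes "quadratic_form f" and zero: "\<And>x y. f (x \<otimes>\<^sub>t y) = 0"
  shows "null_lagrangian f"
proof -
  obtain B where B: "bilinear B" "\<And>\<xi> \<eta>. B \<xi> \<eta> = B \<eta> \<xi>" "\<And>\<xi>. f \<xi> = B \<xi> \<xi>"
    using quadratic_form_symmetric[OF assms(1)] by blast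
  define b where "b i j k l = B (unit_matrix i j) (unit_matrix k l)" for i j k l
  have sym: "b i j k l = b k l i j" for i j k l
    by (simp add: b_def B(2))
  have zeroB: "B (x \<otimes>\<^sub>t y) (x \<otimes>\<^sub>t y) = 0" for x y
    using zero B(3) by metis
  note bil = bilinear_ladd[OF B(1)] bilinear_radd[OF B(1)] tensor_add_left tensor_add_right
  have left: "B (x \<otimes>\<^sub>t y) (x' \<otimes>\<^sub>t y) = 0" for x x' y
    using zeroB[of "x + x'" y] zeroB[of x y] zeroB[of x' y] B(2)[of "x \<otimes>\<^sub>t y" "x' \<otimes>\<^sub>t y"]
    by (simp add: bil)
  have "b i j k l + b i l k j = 0" for i j k l
    using left[of "axis i 1" "axis j 1 + axis l 1" "axis k 1"]
      left[of "axis i 1" "axis j 1" "axis k 1"] left[of "axis i 1" "axis l 1" "axis k 1"]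
    by (simp add: b_def unit_matrix_def bil)
  then have anti: "b i j k l = - b i l k j" for i j k l
    by (simp add: eq_neg_iff_add_eq_0)
  have same_col: "b i j k j = 0" for i j k
    using anti[of i j k j] by simp
  have same_row: "b i j i l = 0" for i j l
    using anti[of i j i l] sym[of i j i l] by simp
  have idx: "1 + 1 = (2::3)" "1 + 2 = (3::3)" "2 + 1 = (3::3)" "2 + 2 = (1::3)"
    "3 + 1 = (1::3)" "3 + 2 = (2::3)"
    by simp_all
  \<comment> \<open>The factor 2 counts each product of two entries in both orders.\<close>
  have f: "f \<xi> = (\<Sum>i\<in>UNIV. \<Sum>j\<in>UNIV. 2 * b (i + 1) (j + 1) (i + 2) (j + 2) * minor i j \<xi>)" for \<xi>
  proof -
    have "f \<xi> = (\<Sum>i\<in>UNIV. \<Sum>j\<in>UNIV. \<Sum>k\<in>UNIV. \<Sum>l\<in>UNIV. \<xi> $ i $ j * \<xi> $ k $ l * b i j k l)"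
      unfolding B(3) b_def by (rule bilinear_coords[OF B(1)])
    then show ?thesis
      unfolding minor_def sum_3 idx same_col same_row
        sym[of 2 _ 1] sym[of 3 _ 2] sym[of 1 _ 3] anti[of _ 2 _ 1] anti[of _ 3 _ 2] anti[of _ 1 _ 3]
      by (simp add: algebra_simps)
  qed
  then show ?thesis
    unfolding null_lagrangian_def
    by (intro exI[of _ "\<lambda>i j. 2 * b (i + 1) (j + 1) (i + 2) (j + 2)"]) simp
qed

section \<open>Inequalities for real numbers\<close>

lemma sum_sq_form_nonneg:
  fixes a b c p q r :: real
  assumes abc: "a * b * c = p * q * r"
  shows "0 \<le> a\<^sup>2 + b\<^sup>2 + c\<^sup>2 - 2 * a * b - 2 * b * c - 2 * c * a + p\<^sup>2 + q\<^sup>2 + r\<^sup>2"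
proof -
  have amgm: "3 * (x * y * z) \<le> x ^ 3 + y ^ 3 + z ^ 3" if "0 \<le> x" "0 \<le> y" "0 \<le> z" for x y z :: real
  proof -
    have "0 \<le> (x + y + z) * ((x - y)\<^sup>2 + (y - z)\<^sup>2 + (z - x)\<^sup>2)"
      using that by simp
    then show ?thesis
      by (simp add: algebra_simps power2_eq_square power3_eq_cube)
  qed
  have schur_ordered: "x\<^sup>2 * y + x\<^sup>2 * z + y\<^sup>2 * x + y\<^sup>2 * z + z\<^sup>2 * x + z\<^sup>2 * y
      \<le> x ^ 3 + y ^ 3 + z ^ 3 + 3 * (x * y * z)"
    if "0 \<le> x" "x \<le> y" "y \<le> z" for x y z :: real
  proof -
    \<comment> \<open>The first summand is nonnegative because \<open>t * (t - x)\<close> increases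
      with \<open>t\<close> for \<open>t \<ge> x\<close>.\<close>
    have "0 \<le> (z - y) * (z * (z - x) - y * (y - x)) + x * ((y - x) * (z - x))"
      using that by (intro add_nonneg_nonneg mult_nonneg_nonneg) (auto intro!: mult_mono)
    then show ?thesis
      by (simp add: algebra_simps power2_eq_square power3_eq_cube)
  qed
  have schur: "x\<^sup>2 * y + x\<^sup>2 * z + y\<^sup>2 * x + y\<^sup>2 * z + z\<^sup>2 * x + z\<^sup>2 * y
      \<le> x ^ 3 + y ^ 3 + z ^ 3 + 3 * (x * y * z)"
    if "0 \<le> x" "0 \<le> y" "0 \<le> z" for x y z :: real
    using that schur_ordered[of x y z] schur_ordered[of x z y] schur_ordered[of y x z]
      schur_ordered[of y z x] schur_ordered[of z x y] schur_ordered[of z y x]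
    by (cases "x \<le> y"; cases "y \<le> z"; cases "x \<le> z") (simp_all add: algebra_simps)
  have pos: "0 \<le> a\<^sup>2 + b\<^sup>2 + c\<^sup>2 - 2 * a * b - 2 * b * c - 2 * c * a + p\<^sup>2 + q\<^sup>2 + r\<^sup>2"
    if "0 \<le> a" "0 \<le> b" "0 \<le> c" "a * b * c = p * q * r" for a b c p q r :: real
  proof -
    define u v w where "u = root 3 a" "v = root 3 b" "w = root 3 c"
    have uvw: "a = u ^ 3" "b = v ^ 3" "c = w ^ 3" "0 \<le> u" "0 \<le> v" "0 \<le> w"
      using that by (auto simp: u_v_w_def)
    define x y z where "x = root 3 (p\<^sup>2)" "y = root 3 (q\<^sup>2)" "z = root 3 (r\<^sup>2)"
    have xyz: "p\<^sup>2 = x ^ 3" "q\<^sup>2 = y ^ 3" "r\<^sup>2 = z ^ 3" "0 \<le> x" "0 \<le> y" "0 \<le> z"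
      by (auto simp: x_y_z_def)
    have "(x * y * z) ^ 3 = (p * q * r)\<^sup>2"
      by (simp add: power_mult_distrib xyz)
    also have "\<dots> = (u\<^sup>2 * v\<^sup>2 * w\<^sup>2) ^ 3"
      unfolding that(4)[symmetric] by (simp add: power_mult_distrib uvw flip: power_mult)
    finally have "x * y * z = u\<^sup>2 * v\<^sup>2 * w\<^sup>2"
      by (rule power_eq_imp_eq_base) (use xyz in auto)
    then have "3 * (u\<^sup>2 * v\<^sup>2 * w\<^sup>2) \<le> p\<^sup>2 + q\<^sup>2 + r\<^sup>2"
      using amgm[of x y z] xyz by simp
    \<comment> \<open>This trades the mixed terms of Schur's inequality in \<open>u\<^sup>2\<close>,
      \<open>v\<^sup>2\<close>, \<open>w\<^sup>2\<close> for the products \<open>2ab\<close>,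
      \<open>2bc\<close>, \<open>2ca\<close>.\<close>
    moreover have "2 * (s ^ 3 * t ^ 3) \<le> (s\<^sup>2)\<^sup>2 * t\<^sup>2 + (t\<^sup>2)\<^sup>2 * s\<^sup>2" for s t :: real
    proof -
      have "0 \<le> (s * t * (s - t))\<^sup>2"
        by simp
      then show ?thesis
        by (simp add: algebra_simps eval_nat_numeral)
    qed
    from this[of u v] this[of v w] this[of w u]
    have "2 * (u ^ 3 * v ^ 3) + 2 * (v ^ 3 * w ^ 3) + 2 * (w ^ 3 * u ^ 3)
      \<le> (u\<^sup>2) ^ 3 + (v\<^sup>2) ^ 3 + (w\<^sup>2) ^ 3 + 3 * (u\<^sup>2 * v\<^sup>2 * w\<^sup>2)"
      using schur[of "u\<^sup>2" "v\<^sup>2" "w\<^sup>2"] uvw by auto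
    ultimately show ?thesis
      by (simp add: uvw(1-3) mult.assoc flip: power_mult)
  qed
  have neg: "0 \<le> a\<^sup>2 + b\<^sup>2 + c\<^sup>2 - 2 * a * b - 2 * b * c - 2 * c * a + p\<^sup>2 + q\<^sup>2 + r\<^sup>2"
    if "a \<le> 0" "0 \<le> b" "0 \<le> c" for a b c :: real
  proof -
    have "0 \<le> (b - c)\<^sup>2 + a\<^sup>2 + 2 * (- a * (b + c)) + p\<^sup>2 + q\<^sup>2 + r\<^sup>2"
      using that by (intro add_nonneg_nonneg mult_nonneg_nonneg) auto
    then show ?thesis
      by (simp add: algebra_simps power2_eq_square)
  qed
  \<comment> \<open>Negating \<open>a\<close>, \<open>b\<close>, \<open>c\<close> keeps the form,
    and negating \<open>p\<close> as well keeps \<open>abc = pqr\<close>, so every sign pattern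
    falls under \<open>pos\<close> or \<open>neg\<close>.\<close>
  show ?thesis
    using pos[of a b c p q r] pos[of "- a" "- b" "- c" "- p" q r]
      neg[of a b c] neg[of b c a] neg[of c a b]
      neg[of "- a" "- b" "- c"] neg[of "- b" "- c" "- a"] neg[of "- c" "- a" "- b"] abc
    by (cases "0 \<le> a"; cases "0 \<le> b"; cases "0 \<le> c") (simp_all add: algebra_simps)
qed

text \<open>Near 0 the linear term outweighs the quadratic one. This turns zeros of a nonnegative
  form into critical points.\<close>

lemma quadratic_polynomial_nonneg_imp_linear_coeff_zero:
  fixes b c :: real
  assumes "\<And>t. 0 \<le> 2 * b * t + c * t\<^sup>2"
  shows "b = 0"
proof -
  \<comment> \<open>Since \<open>m\<close> exceeds \<open>c / 2\<close>, the value at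
    \<open>t = - b / m\<close> is a negative multiple of \<open>b\<^sup>2\<close>.\<close>
  define m where "m = \<bar>c\<bar> + 1"
  have m: "0 < m" "c < 2 * m"
    by (auto simp: m_def)
  have "0 \<le> m\<^sup>2 * (2 * b * (- b / m) + c * (- b / m)\<^sup>2)"
    using assms[of "- b / m"] by (intro mult_nonneg_nonneg) auto
  also have "\<dots> = b\<^sup>2 * (c - 2 * m)"
    using m by (simp add: field_simps power2_eq_square)
  finally show ?thesis
    using m by (simp add: zero_le_mult_iff)
qed

text \<open>Dividing by \<open>s\<^sup>2\<close> and letting \<open>s\<close> tend to 0 from the
  right isolates \<open>A\<close>, which will be a Hessian.\<close>

lemma leading_coeff_nonneg_at_0:
  fixes A B C :: real
  assumes "\<And>s. 0 \<le> A * s\<^sup>2 + B * s ^ 3 + C * s ^ 4"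
  shows "0 \<le> A"
proof (rule tendsto_lowerbound)
  show "((\<lambda>s. A + B * s + C * s\<^sup>2) \<longlongrightarrow> A) (at_right 0)"
    by (auto intro!: tendsto_eq_intros)
  have "0 \<le> A + B * s + C * s\<^sup>2" if "0 < s" for s
  proof -
    have "0 \<le> s\<^sup>2 * (A + B * s + C * s\<^sup>2)"
      using assms[of s] by (simp add: algebra_simps eval_nat_numeral)
    then show ?thesis
      using that by (simp add: zero_le_mult_iff)
  qed
  then show "\<forall>\<^sub>F s in at_right 0. 0 \<le> A + B * s + C * s\<^sup>2"
    by (auto simp: eventually_at_right_field intro: exI[of _ 1])
qed simp

section \<open>The case \<alpha> = \<beta> = \<gamma> = 1\<close>

definition cyclic_form :: "real^3^3 \<Rightarrow> real"
  where "cyclic_form \<xi> = (\<xi> $ 1 $ 1)\<^sup>2 + (\<xi> $ 2 $ 2)\<^sup>2 + (\<xi> $ 3 $ 3)\<^sup>2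
    - 2 * \<xi> $ 1 $ 1 * \<xi> $ 2 $ 2 - 2 * \<xi> $ 2 $ 2 * \<xi> $ 3 $ 3 - 2 * \<xi> $ 3 $ 3 * \<xi> $ 1 $ 1
    + (\<xi> $ 1 $ 2)\<^sup>2 + (\<xi> $ 2 $ 3)\<^sup>2 + (\<xi> $ 3 $ 1)\<^sup>2"

lemma cyclic_form_tensor_nonneg: "0 \<le> cyclic_form (x \<otimes>\<^sub>t y)"
  using sum_sq_form_nonneg[of "x $ 1 * y $ 1" "x $ 2 * y $ 2" "x $ 3 * y $ 3"
      "x $ 1 * y $ 2" "x $ 2 * y $ 3" "x $ 3 * y $ 1"]
  by (simp add: cyclic_form_def mult_ac)

lemma cyclic_form_extremal_on_tensors:
  assumes "quadratic_form g" and nonneg: "\<And>x y. 0 \<le> g (x \<otimes>\<^sub>t y)"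
    and le: "\<And>x y. g (x \<otimes>\<^sub>t y) \<le> cyclic_form (x \<otimes>\<^sub>t y)"
  shows "\<exists>t. \<forall>x y. g (x \<otimes>\<^sub>t y) = t * cyclic_form (x \<otimes>\<^sub>t y)"
proof -
  obtain B where B: "bilinear B" "\<And>\<xi> \<eta>. B \<xi> \<eta> = B \<eta> \<xi>" "\<And>\<xi>. g \<xi> = B \<xi> \<xi>"
    using quadratic_form_symmetric[OF assms(1)] by blast
  define b where "b i j k l = B (unit_matrix i j) (unit_matrix k l)" for i j k l
  have sym: "b i j k l = b k l i j" for i j k l
    by (simp add: b_def B(2))
  note bil = bilinear_ladd[OF B(1)] bilinear_radd[OF B(1)] bilinear_lmul[OF B(1)] bilinear_rmul[OF B(1)]
    tensor_add_left tensor_add_right tensor_scale_left tensor_scale_right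
  \<comment> \<open>Varying a single factor keeps the matrix rank-one, so \<open>g\<close> stays
    nonnegative along the line and its first-order term must vanish.\<close>
  have left: "B (x \<otimes>\<^sub>t y) (z \<otimes>\<^sub>t y) = 0" and right: "B (x \<otimes>\<^sub>t y) (x \<otimes>\<^sub>t z) = 0"
    if "cyclic_form (x \<otimes>\<^sub>t y) = 0" for x y z
  proof -
    have 0: "B (x \<otimes>\<^sub>t y) (x \<otimes>\<^sub>t y) = 0"
      using nonneg[of x y] le[of x y] that by (simp add: B(3))
    have "0 \<le> 2 * B (x \<otimes>\<^sub>t y) (z \<otimes>\<^sub>t y) * t + B (z \<otimes>\<^sub>t y) (z \<otimes>\<^sub>t y) * t\<^sup>2" for t
      using nonneg[of "x + t *\<^sub>R z" y] 0 B(2)[of "z \<otimes>\<^sub>t y" "x \<otimes>\<^sub>t y"]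
      by (simp add: B(3) bil power2_eq_square algebra_simps)
    then show "B (x \<otimes>\<^sub>t y) (z \<otimes>\<^sub>t y) = 0"
      by (rule quadratic_polynomial_nonneg_imp_linear_coeff_zero)
    have "0 \<le> 2 * B (x \<otimes>\<^sub>t y) (x \<otimes>\<^sub>t z) * t + B (x \<otimes>\<^sub>t z) (x \<otimes>\<^sub>t z) * t\<^sup>2" for t
      using nonneg[of x "y + t *\<^sub>R z"] 0 B(2)[of "x \<otimes>\<^sub>t z" "x \<otimes>\<^sub>t y"]
      by (simp add: B(3) bil power2_eq_square algebra_simps)
    then show "B (x \<otimes>\<^sub>t y) (x \<otimes>\<^sub>t z) = 0"
      by (rule quadratic_polynomial_nonneg_imp_linear_coeff_zero)
  qed
  have unit_zero: "b i k l k = 0 \<and> b i k i l = 0 \<and> b l k i k = 0 \<and> b i l i k = 0"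
    if "(i, k) \<in> {(1, 3), (2, 1), (3, 2)}" for i k l
  proof -
    have "cyclic_form (axis i 1 \<otimes>\<^sub>t axis k 1) = 0"
      using that unfolding insert_iff prod.inject empty_iff
      by (elim disjE conjE FalseE) (simp_all add: cyclic_form_def axis_def)
    from left[OF this, of "axis l 1"] right[OF this, of "axis l 1"]
    have "b i k l k = 0" "b i k i l = 0"
      by (simp_all add: b_def unit_matrix_def)
    then show ?thesis
      using sym[of l k i k] sym[of i l i k] by simp
  qed
  have hessian: "b i i i i = b k k k k \<and> b i i k k + b i k k i = - b i i i i"
    if ik: "(i, k) \<in> {(1, 3), (2, 1), (3, 2)}" for i k
  proof -
    define m where "m = b i i k k + b i k k i"
    \<comment> \<open>At second order in \<open>s\<close>, the form on \<open>X s v w\<close> is its Hessian at the zero \<open>e\<^sub>i \<otimes> e\<^sub>k\<close>.\<close>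
    define X where "X s v w = (axis i 1 + (s * v) *\<^sub>R axis k 1) \<otimes>\<^sub>t ((s * w) *\<^sub>R axis i 1 + axis k 1)"
      for s v w :: real
    have F: "cyclic_form (X s v w) = (v - w)\<^sup>2 * s\<^sup>2 + v\<^sup>2 * w\<^sup>2 * s ^ 4" for s v w
      using ik unfolding insert_iff prod.inject empty_iff
      by (elim disjE conjE FalseE)
        (simp_all add: X_def cyclic_form_def axis_def algebra_simps eval_nat_numeral)
    have *: "b i k i k = 0" "b i k i i = 0" "b i i i k = 0" "b i k k k = 0" "b k k i k = 0"
      using unit_zero[OF ik] by blast+
    have g: "g (X s v w) = (b i i i i * w\<^sup>2 + 2 * m * (v * w) + b k k k k * v\<^sup>2) * s\<^sup>2
       + (2 * v * w\<^sup>2 * b i i k i + 2 * v\<^sup>2 * w * b k k k i) * s ^ 3 + v\<^sup>2 * w\<^sup>2 * b k i k i * s ^ 4" for s v w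
      unfolding B(3) X_def bil unit_matrix_def[symmetric] b_def[symmetric]
      using * sym[of i i k i] sym[of i i k k] sym[of k k k i] sym[of i k k i]
      by (simp add: m_def algebra_simps eval_nat_numeral)
    have lower: "0 \<le> b i i i i * w\<^sup>2 + 2 * m * (v * w) + b k k k k * v\<^sup>2" for v w
    proof (rule leading_coeff_nonneg_at_0)
      fix s
      have "0 \<le> g (X s v w)"
        unfolding X_def by (rule nonneg)
      then show "0 \<le> (b i i i i * w\<^sup>2 + 2 * m * (v * w) + b k k k k * v\<^sup>2) * s\<^sup>2
        + (2 * v * w\<^sup>2 * b i i k i + 2 * v\<^sup>2 * w * b k k k i) * s ^ 3 + v\<^sup>2 * w\<^sup>2 * b k i k i * s ^ 4"
        unfolding g .
    qed
    have "0 \<le> (v - w)\<^sup>2 - (b i i i i * w\<^sup>2 + 2 * m * (v * w) + b k k k k * v\<^sup>2)" for v w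
    proof (rule leading_coeff_nonneg_at_0)
      fix s
      have "g (X s v w) \<le> cyclic_form (X s v w)"
        unfolding X_def by (rule le)
      then show "0 \<le> ((v - w)\<^sup>2 - (b i i i i * w\<^sup>2 + 2 * m * (v * w) + b k k k k * v\<^sup>2)) * s\<^sup>2
        + (- (2 * v * w\<^sup>2 * b i i k i + 2 * v\<^sup>2 * w * b k k k i)) * s ^ 3
        + (v\<^sup>2 * w\<^sup>2 - v\<^sup>2 * w\<^sup>2 * b k i k i) * s ^ 4"
        unfolding F g by (simp add: algebra_simps)
    qed
    \<comment> \<open>The direction \<open>v = w\<close> spans the kernel of the Hessian
      \<open>(v - w)\<^sup>2\<close> of \<open>cyclic_form\<close>, so both bounds meet
      there.\<close>
    from this[of 1 1] lower[of 1 1] have zero: "b i i i i + 2 * m + b k k k k = 0"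
      by simp
    \<comment> \<open>The Hessian of \<open>g\<close> is nonnegative and vanishes at
      \<open>v = w = 1\<close>, so its derivative in \<open>v\<close> is 0 there.\<close>
    have "m + b k k k k = 0"
    proof (rule quadratic_polynomial_nonneg_imp_linear_coeff_zero)
      show "0 \<le> 2 * (m + b k k k k) * t + b k k k k * t\<^sup>2" for t
        using lower[where v = "1 + t" and w = 1] zero by (simp add: algebra_simps power2_eq_square)
    qed
    then show ?thesis
      using zero by (simp add: m_def)
  qed
  have expand: "B (x \<otimes>\<^sub>t y) (z \<otimes>\<^sub>t w) = (\<Sum>i\<in>UNIV. \<Sum>j\<in>UNIV. \<Sum>k\<in>UNIV. \<Sum>l\<in>UNIV.
      x $ i * y $ j * (z $ k * w $ l) * b i j k l)" for x y z w
    unfolding b_def by (subst bilinear_coords[OF B(1)]) simp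
  \<comment> \<open>Used as rewrite rules, these put the lexicographically smaller index pair
    first.\<close>
  have sym_norm: "b 2 i 1 j = b 1 j 2 i" "b 3 i 1 j = b 1 j 3 i" "b 3 i 2 j = b 2 j 3 i"
    "b i 2 i 1 = b i 1 i 2" "b i 3 i 1 = b i 1 i 3" "b i 3 i 2 = b i 2 i 3" for i j
    by (rule sym)+
  have z: "b 1 3 l 3 = 0" "b 1 3 1 l = 0" "b l 3 1 3 = 0" "b 1 l 1 3 = 0"
    "b 2 1 l 1 = 0" "b 2 1 2 l = 0" "b l 1 2 1 = 0" "b 2 l 2 1 = 0"
    "b 3 2 l 2 = 0" "b 3 2 3 l = 0" "b l 2 3 2 = 0" "b 3 l 3 2 = 0" for l
    using unit_zero[of 1 3 l] unit_zero[of 2 1 l] unit_zero[of 3 2 l] by simp_all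
  have sum_axis_left: "(\<Sum>i\<in>UNIV. \<Sum>l\<in>UNIV. a * (axis k 1 $ i * w $ l) * f i l) = (\<Sum>l\<in>UNIV. a * w $ l * f k l)"
    and sum_axis_right: "(\<Sum>l\<in>UNIV. \<Sum>i\<in>UNIV. a * (w $ l * axis k 1 $ i) * f l i) = (\<Sum>l\<in>UNIV. a * w $ l * f l k)"
    for a :: real and k :: 3 and w :: "real^3" and f
    using exhaust_3[of k] by (auto simp: axis_def sum_3)
  \<comment> \<open>Criticality at \<open>e \<otimes>\<^sub>t e\<close> when either factor moves
    along the \<open>k\<close>-th axis. The other four sign vectors are negatives of these and give
    the same matrices.\<close>
  have sign_zero: "(\<Sum>i\<in>UNIV. \<Sum>j\<in>UNIV. \<Sum>l\<in>UNIV. e $ i * e $ j * e $ l * b i j k l) = 0"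
    "(\<Sum>i\<in>UNIV. \<Sum>j\<in>UNIV. \<Sum>l\<in>UNIV. e $ i * e $ j * e $ l * b i j l k) = 0"
    if e: "e \<in> {vector [1, 1, 1], vector [-1, 1, 1], vector [1, -1, 1], vector [1, 1, -1]}" for e k
  proof -
    have 0: "cyclic_form (e \<otimes>\<^sub>t e) = 0"
      using e by (auto simp: cyclic_form_def)
    have "B (x \<otimes>\<^sub>t y) (axis k 1 \<otimes>\<^sub>t w) =
        (\<Sum>i\<in>UNIV. \<Sum>j\<in>UNIV. \<Sum>l\<in>UNIV. x $ i * y $ j * w $ l * b i j k l)" for x y w
      unfolding expand by (rule sum.cong, simp, rule sum.cong, simp, rule sum_axis_left)
    then show "(\<Sum>i\<in>UNIV. \<Sum>j\<in>UNIV. \<Sum>l\<in>UNIV. e $ i * e $ j * e $ l * b i j k l) = 0"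
      using left[OF 0, of "axis k 1"] by simp
    have "B (x \<otimes>\<^sub>t y) (z \<otimes>\<^sub>t axis k 1) =
        (\<Sum>i\<in>UNIV. \<Sum>j\<in>UNIV. \<Sum>l\<in>UNIV. x $ i * y $ j * z $ l * b i j l k)" for x y z
      unfolding expand by (rule sum.cong, simp, rule sum.cong, simp, rule sum_axis_right)
    then show "(\<Sum>i\<in>UNIV. \<Sum>j\<in>UNIV. \<Sum>l\<in>UNIV. e $ i * e $ j * e $ l * b i j l k) = 0"
      using right[OF 0, of "axis k 1"] by simp
  qed
  let ?e = "vector [1, 1, 1] :: real^3" and ?e1 = "vector [-1, 1, 1] :: real^3"
    and ?e2 = "vector [1, -1, 1] :: real^3" and ?e3 = "vector [1, 1, -1] :: real^3"
  \<comment> \<open>The multiplier is read off from the square of the first diagonal entry, whose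
    coefficient in \<open>cyclic_form\<close> is 1.\<close>
  define t where "t = b 1 1 1 1"
  \<comment> \<open>Only the sum of the two coefficients sharing a monomial is determined, since a
    minor shifts one against the other; \<open>minors\<close> eliminates one of each pair.\<close>
  have diag: "b 1 1 1 1 = t" "b 2 2 2 2 = t" "b 3 3 3 3 = t"
    and minors: "b 1 2 2 1 = - t - b 1 1 2 2" "b 1 3 3 1 = - t - b 1 1 3 3" "b 2 3 3 2 = - t - b 2 2 3 3"
    using hessian[of 1 3] hessian[of 2 1] hessian[of 3 2] by (auto simp: t_def sym_norm)
  have L: "(\<Sum>i\<in>UNIV. \<Sum>j\<in>UNIV. \<Sum>l\<in>UNIV. ?e $ i * ?e $ j * ?e $ l * b i j k l) = 0"
    "(\<Sum>i\<in>UNIV. \<Sum>j\<in>UNIV. \<Sum>l\<in>UNIV. ?e1 $ i * ?e1 $ j * ?e1 $ l * b i j k l) = 0"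
    "(\<Sum>i\<in>UNIV. \<Sum>j\<in>UNIV. \<Sum>l\<in>UNIV. ?e2 $ i * ?e2 $ j * ?e2 $ l * b i j k l) = 0"
    "(\<Sum>i\<in>UNIV. \<Sum>j\<in>UNIV. \<Sum>l\<in>UNIV. ?e3 $ i * ?e3 $ j * ?e3 $ l * b i j k l) = 0" for k
    by (rule sign_zero; simp)+
  have R: "(\<Sum>i\<in>UNIV. \<Sum>j\<in>UNIV. \<Sum>l\<in>UNIV. ?e $ i * ?e $ j * ?e $ l * b i j l k) = 0"
    "(\<Sum>i\<in>UNIV. \<Sum>j\<in>UNIV. \<Sum>l\<in>UNIV. ?e1 $ i * ?e1 $ j * ?e1 $ l * b i j l k) = 0"
    "(\<Sum>i\<in>UNIV. \<Sum>j\<in>UNIV. \<Sum>l\<in>UNIV. ?e2 $ i * ?e2 $ j * ?e2 $ l * b i j l k) = 0"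
    "(\<Sum>i\<in>UNIV. \<Sum>j\<in>UNIV. \<Sum>l\<in>UNIV. ?e3 $ i * ?e3 $ j * ?e3 $ l * b i j l k) = 0" for k
    by (rule sign_zero; simp)+
  \<comment> \<open>Averaging over the four signs separates the monomials by the parity of their exponents.\<close>
  note L1 = L[of 1, simplified sum_3 vector_3 z sym_norm diag minors, simplified]
    and L2 = L[of 2, simplified sum_3 vector_3 z sym_norm diag minors, simplified]
    and L3 = L[of 3, simplified sum_3 vector_3 z sym_norm diag minors, simplified]
    and R1 = R[of 1, simplified sum_3 vector_3 z sym_norm diag minors, simplified]
    and R2 = R[of 2, simplified sum_3 vector_3 z sym_norm diag minors, simplified]
    and R3 = R[of 3, simplified sum_3 vector_3 z sym_norm diag minors, simplified]
  \<comment> \<open>Each parenthesized sum is half the coefficient of one monomial of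
    \<open>g (x \<otimes>\<^sub>t y)\<close>.\<close>
  have L1': "b 1 2 1 2 = t" "2 * b 1 1 1 2 + b 1 2 2 2 + (b 1 2 3 3 + b 1 3 3 2) = 0"
    "b 1 1 3 1 + (b 1 2 2 3 + b 1 3 2 2) = 0" "b 1 1 2 3 + b 1 3 2 1 + (b 1 1 3 2 + b 1 2 3 1) = 0"
    using L1 by linarith+
  have L2': "b 2 3 2 3 = t" "b 1 2 2 2 + (b 2 1 3 3 + b 2 3 3 1) = 0"
    "2 * b 2 2 2 3 + b 2 3 3 3 + (b 1 1 2 3 + b 1 3 2 1) = 0" "b 1 2 2 3 + b 1 3 2 2 + (b 2 1 3 2 + b 2 2 3 1) = 0"
    using L2 by linarith+
  have L3': "b 3 1 3 1 = t" "b 2 3 3 3 + (b 1 1 3 2 + b 1 2 3 1) = 0"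
    "2 * b 3 1 3 3 + b 1 1 3 1 + (b 2 1 3 2 + b 2 2 3 1) = 0" "b 1 2 3 3 + b 1 3 3 2 + (b 2 1 3 3 + b 2 3 3 1) = 0"
    using L3 by linarith+
  have R': "b 1 1 1 2 + (b 2 1 3 3 + b 2 3 3 1) = 0" "b 2 2 2 3 + (b 1 1 3 2 + b 1 2 3 1) = 0"
    "b 3 1 3 3 + (b 1 2 2 3 + b 1 3 2 2) = 0"
    by (use R1 in linarith, use R2 in linarith, use R3 in linarith)
  \<comment> \<open>Opposite coefficients belong to a common monomial and cancel on rank-one
    matrices.\<close>
  have rest: "b 1 1 1 2 = 0" "b 1 2 2 2 = 0" "b 1 3 3 2 = - b 1 2 3 3" "b 2 3 3 1 = - b 2 1 3 3"
    "b 2 2 2 3 = 0" "b 2 3 3 3 = 0" "b 1 3 2 1 = - b 1 1 2 3" "b 1 2 3 1 = - b 1 1 3 2"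
    "b 3 1 3 3 = 0" "b 1 1 3 1 = 0" "b 1 3 2 2 = - b 1 2 2 3" "b 2 2 3 1 = - b 2 1 3 2"
    using L1'(2-) L2'(2-) L3'(2-) R' by linarith+
  have "g (x \<otimes>\<^sub>t y) = t * cyclic_form (x \<otimes>\<^sub>t y)" for x y
    unfolding B(3) expand sum_3 z sym_norm diag minors rest L1'(1) L2'(1) L3'(1) cyclic_form_def tensor_nth
    by (simp add: algebra_simps power2_eq_square)
  then show ?thesis
    by blast
qed

section \<open>Reduction of the general case by diagonal conjugation\<close>

theorem corollary1p6:
  fixes \<alpha> \<beta> \<gamma> :: real
  assumes "\<alpha> > 0" and "\<beta> > 0" and "\<gamma> > 0" and "\<alpha> * \<beta> * \<gamma> = 1"
  shows "extremal_quasiconvex_form (\<lambda>\<xi> :: real^3^3.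
    ((\<xi> $ 1 $ 1)\<^sup>2 + (\<xi> $ 2 $ 2)\<^sup>2 + (\<xi> $ 3 $ 3)\<^sup>2
      - 2 * (\<xi> $ 1 $ 1) * (\<xi> $ 2 $ 2) - 2 * (\<xi> $ 2 $ 2) * (\<xi> $ 3 $ 3) - 2 * (\<xi> $ 3 $ 3) * (\<xi> $ 1 $ 1))
    + \<alpha> * (\<xi> $ 1 $ 2)\<^sup>2 + \<beta> * (\<xi> $ 2 $ 3)\<^sup>2 + \<gamma> * (\<xi> $ 3 $ 1)\<^sup>2)"
    (is "extremal_quasiconvex_form ?Q")
proof -
  have Q: "quadratic_form ?Q"
    unfolding quadratic_form_def
  proof (intro exI conjI allI)
    let ?B = "\<lambda>\<xi> \<eta> :: real^3^3. \<xi> $ 1 $ 1 * \<eta> $ 1 $ 1 + \<xi> $ 2 $ 2 * \<eta> $ 2 $ 2 + \<xi> $ 3 $ 3 * \<eta> $ 3 $ 3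
      - 2 * \<xi> $ 1 $ 1 * \<eta> $ 2 $ 2 - 2 * \<xi> $ 2 $ 2 * \<eta> $ 3 $ 3 - 2 * \<xi> $ 3 $ 3 * \<eta> $ 1 $ 1
      + \<alpha> * \<xi> $ 1 $ 2 * \<eta> $ 1 $ 2 + \<beta> * \<xi> $ 2 $ 3 * \<eta> $ 2 $ 3 + \<gamma> * \<xi> $ 3 $ 1 * \<eta> $ 3 $ 1"
    show "bilinear ?B"
      unfolding bilinear_def by (auto intro!: linearI simp: algebra_simps)
    show "?Q \<xi> = ?B \<xi> \<xi>" for \<xi>
      by (simp add: power2_eq_square mult.assoc)
  qed
  \<comment> \<open>The ratios \<open>s\<^sub>1/s\<^sub>2\<close>,
    \<open>s\<^sub>2/s\<^sub>3\<close>, \<open>s\<^sub>3/s\<^sub>1\<close> have to be the inverse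
    square roots of \<alpha>, \<beta>, \<gamma>. Their product is 1, which is where
    \<alpha>\<beta>\<gamma> = 1 enters.\<close>
  define s :: "real^3" where "s = vector [sqrt \<gamma>, 1 / sqrt \<beta>, 1]"
  have s: "s $ i \<noteq> 0" for i
    using assms exhaust_3[of i] by (auto simp: s_def)
  define T :: "real^3^3 \<Rightarrow> real^3^3" where "T \<xi> = (\<chi> i j. s $ i * \<xi> $ i $ j / s $ j)" for \<xi>
  have "linear T"
    by (rule linearI) (simp_all add: T_def vec_eq_iff field_simps add_divide_distrib)
  have QT: "?Q (T \<xi>) = cyclic_form \<xi>" for \<xi>
  proof -
    have "\<alpha> * (T \<xi> $ 1 $ 2)\<^sup>2 = (\<alpha> * \<beta> * \<gamma>) * (\<xi> $ 1 $ 2)\<^sup>2"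
      using assms(1-3) by (simp add: T_def s_def power_mult_distrib)
    moreover have "\<beta> * (T \<xi> $ 2 $ 3)\<^sup>2 = (\<xi> $ 2 $ 3)\<^sup>2" "\<gamma> * (T \<xi> $ 3 $ 1)\<^sup>2 = (\<xi> $ 3 $ 1)\<^sup>2"
      using assms by (simp_all add: T_def s_def power_divide)
    moreover have "T \<xi> $ i $ i = \<xi> $ i $ i" for i
      using s[of i] by (simp add: T_def)
    ultimately show ?thesis
      using assms(4) by (simp add: cyclic_form_def)
  qed
  \<comment> \<open>Conjugation maps the rank-one matrices onto themselves, so inequalities and
    identities on them transfer both ways.\<close>
  have T_tensor: "T (x \<otimes>\<^sub>t y) = (\<chi> i. s $ i * x $ i) \<otimes>\<^sub>t (\<chi> j. y $ j / s $ j)" for x y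
    by (simp add: T_def vec_eq_iff)
  have tensor_T: "\<exists>x' y'. x \<otimes>\<^sub>t y = T (x' \<otimes>\<^sub>t y')" for x y
    using s by (intro exI[of _ "\<chi> i. x $ i / s $ i"] exI[of _ "\<chi> j. y $ j * s $ j"])
      (simp add: T_def vec_eq_iff)
  have Q_quasiconvex: "quasiconvex_form ?Q"
    unfolding quasiconvex_form_def
  proof (intro conjI allI Q)
    fix x y
    obtain x' y' where eq: "x \<otimes>\<^sub>t y = T (x' \<otimes>\<^sub>t y')"
      using tensor_T by blast
    show "0 \<le> ?Q (x \<otimes>\<^sub>t y)"
      unfolding eq QT by (rule cyclic_form_tensor_nonneg)
  qed
  have extremal: "\<exists>t. null_lagrangian (\<lambda>\<xi>. g \<xi> - t * ?Q \<xi>)"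
    if g: "quasiconvex_form g" and diff: "quasiconvex_form (\<lambda>\<xi>. ?Q \<xi> - g \<xi>)" for g
  proof -
    have "\<exists>t. \<forall>x y. g (T (x \<otimes>\<^sub>t y)) = t * cyclic_form (x \<otimes>\<^sub>t y)"
    proof (rule cyclic_form_extremal_on_tensors)
      show "quadratic_form (\<lambda>\<xi>. g (T \<xi>))"
        using g \<open>linear T\<close> by (auto simp: quasiconvex_form_def intro: quadratic_form_linear_compose)
      show "0 \<le> g (T (x \<otimes>\<^sub>t y))" for x y
        using g by (simp add: quasiconvex_form_def T_tensor)
      have "0 \<le> ?Q (T (x \<otimes>\<^sub>t y)) - g (T (x \<otimes>\<^sub>t y))" for x y
        using diff unfolding quasiconvex_form_def T_tensor by blast
      then show "g (T (x \<otimes>\<^sub>t y)) \<le> cyclic_form (x \<otimes>\<^sub>t y)" for x y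
        unfolding QT by simp
    qed
    then obtain t where t: "g (T (x \<otimes>\<^sub>t y)) = t * ?Q (T (x \<otimes>\<^sub>t y))" for x y
      unfolding QT by blast
    have "null_lagrangian (\<lambda>\<xi>. g \<xi> - t * ?Q \<xi>)"
    proof (rule null_lagrangianI)
      show "quadratic_form (\<lambda>\<xi>. g \<xi> - t * ?Q \<xi>)"
        using g Q by (auto simp: quasiconvex_form_def intro: quadratic_form_diff_scale)
      show "g (x \<otimes>\<^sub>t y) - t * ?Q (x \<otimes>\<^sub>t y) = 0" for x y
      proof -
        obtain x' y' where eq: "x \<otimes>\<^sub>t y = T (x' \<otimes>\<^sub>t y')"
          using tensor_T by blast
        show ?thesis
          using t[of x' y'] unfolding eq by simp
      qed
    qed
    then show ?thesis
      by (rule exI[of _ t])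
  qed
  show ?thesis
    unfolding extremal_quasiconvex_form_def
  proof (intro conjI allI impI Q_quasiconvex)
    fix g
    assume g: "quasiconvex_form g \<and> quasiconvex_form (\<lambda>\<xi>. ?Q \<xi> - g \<xi>)"
    show "\<exists>t. null_lagrangian (\<lambda>\<xi>. g \<xi> - t * ?Q \<xi>)"
      by (rule extremal[OF conjunct1[OF g] conjunct2[OF g]])
  qed
qed

end
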